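(* Let $K$ be a field of characteristic $0$, let $n\ge 1$ and $0\le i\le n-1$ be integers. Let $\mathcal{X}(i,n)$ denote the image of the linear map $L: K^n\to \operatorname{Hom}(\bigwedge^i K^n,\bigwedge^{i+1}K^n)$, $v\mapsto L_v$, where $L_v(x)=v\wedge x$. Then: (1) $\operatorname{ncrk}(\mathcal{X}(i,n))$ is full, i.e. equals $\min\{\binom{n}{i},\binom{n}{i+1}\}$; (2) if $i\ne 0,n-1$, then $\operatorname{rk}(\mathcal{X}(i,n))$ is not full, i.e. is strictly less than $\min\{\binom{n}{i},\binom{n}{i+1}\}$.
   Context: After choosing bases, $\operatorname{Hom}(V,W)$ is identified with a space of matrices. For a linear subspace $\mathcal{X}\subseteq\operatorname{Mat}_{k,l}(K)$, $\operatorname{rk}(\mathcal{X})$ denotes the maximal rank among its members. For $d\ge 1$, the tensor blow-up is $\mathcal{X}^{\{d\}}=\mathcal{X}\otimes \operatorname{Mat}_{d,d}(K)=\{\sum_i X_i\otimes T_i \mid X_i\in\mathcal{X},\ T_i\in\operatorname{Mat}_{d,d}(K)\}\subseteq\operatorname{Mat}_{kd,ld}(K)$ (Kronecker product). The non-commutative rank is $\operatorname{ncrk}(\mathcal{X})=\max_{d\ge 1}\frac{\operatorname{rk}(\mathcal{X}^{\{d\}})}{d}=\lim_{d\to\infty}\frac{\operatorname{rk}(\mathcal{X}^{\{d\}})}{d}$ (both exist and agree). *)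

theory Defs
  imports "Jordan_Normal_Form.DL_Rank"
begin

text \<open>
  The exterior algebra of $K^n$ in coordinates: an element is its family of coefficients
  with respect to the products $e_S = e_{s_1} \wedge \dots \wedge e_{s_k}$, where
  $S = \{s_1 < \dots < s_k\}$ is a subset of $\{0, \dots, n-1\}$.
\<close>

type_synonym 'a ext = "nat set \<Rightarrow> 'a"

definition ext_power :: "nat \<Rightarrow> nat \<Rightarrow> 'a::comm_ring_1 ext set" where
  "ext_power i n = {x. \<forall>S. x S \<noteq> 0 \<longrightarrow> S \<subseteq> {..<n} \<and> card S = i}"

definition ext_basis :: "nat set \<Rightarrow> 'a::comm_ring_1 ext" where
  "ext_basis S = (\<lambda>T. if T = S then 1 else 0)"

text \<open>For disjoint $T$ and $U$ this is the sign in $e_T \wedge e_U = \pm e_{T \cup U}$.\<close>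

definition shuffle_sign :: "nat set \<Rightarrow> nat set \<Rightarrow> 'a::comm_ring_1" where
  "shuffle_sign T U = (- 1) ^ card {(t, u). t \<in> T \<and> u \<in> U \<and> u < t}"

definition wedge :: "'a::comm_ring_1 ext \<Rightarrow> 'a ext \<Rightarrow> 'a ext"  (infixr "\<and>\<^sub>e" 70) where
  "x \<and>\<^sub>e y = (\<lambda>S. \<Sum>T\<in>Pow S. shuffle_sign T (S - T) * x T * y (S - T))"

definition ext_vec :: "'a::comm_ring_1 vec \<Rightarrow> 'a ext" where
  "ext_vec v = (\<lambda>S. \<Sum>j<dim_vec v. v $ j * ext_basis {j} S)"

definition left_wedge :: "'a::comm_ring_1 vec \<Rightarrow> 'a ext \<Rightarrow> 'a ext" where
  "left_wedge v x = ext_vec v \<and>\<^sub>e x"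

text \<open>The \<open>i\<close>-element subsets of $\{0, \dots, n-1\}$ in lexicographic order.\<close>

definition ksubsets :: "nat \<Rightarrow> nat \<Rightarrow> nat set list" where
  "ksubsets i n = map set (filter (\<lambda>xs. length xs = i) (subseqs [0..<n]))"

definition ext_coords :: "nat \<Rightarrow> nat \<Rightarrow> 'a::comm_ring_1 ext \<Rightarrow> 'a vec" where
  "ext_coords i n x = vec (n choose i) (\<lambda>r. x (ksubsets i n ! r))"

text \<open>The matrix, with respect to the bases $(e_S)$, of a linear map from the \<open>i\<close>-th to the
  \<open>j\<close>-th exterior power.\<close>

definition ext_matrix :: "nat \<Rightarrow> nat \<Rightarrow> nat \<Rightarrow> ('a::comm_ring_1 ext \<Rightarrow> 'a ext) \<Rightarrow> 'a mat" where
  "ext_matrix i j n F =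
     mat (n choose j) (n choose i) (\<lambda>(r, c). F (ext_basis (ksubsets i n ! c)) (ksubsets j n ! r))"

definition wedge_space :: "nat \<Rightarrow> nat \<Rightarrow> 'a::comm_ring_1 mat set" where
  "wedge_space i n = (\<lambda>v. ext_matrix i (i + 1) n (left_wedge v)) ` carrier_vec n"


definition max_rank :: "'a::field mat set \<Rightarrow> nat" where
  "max_rank X = Max ((\<lambda>A. vec_space.rank (dim_row A) A) ` X)"

definition kronecker :: "'a::semiring_1 mat \<Rightarrow> 'a mat \<Rightarrow> 'a mat"  (infixl "\<otimes>\<^sub>k" 70) where
  "A \<otimes>\<^sub>k B = mat (dim_row A * dim_row B) (dim_col A * dim_col B)
     (\<lambda>(r, c). A $$ (r div dim_row B, c div dim_col B) * B $$ (r mod dim_row B, c mod dim_col B))"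

text \<open>The blow-up of a space \<open>X\<close> of \<open>k\<close> by \<open>l\<close> matrices.\<close>

definition blow_up :: "nat \<Rightarrow> nat \<Rightarrow> nat \<Rightarrow> 'a::field mat set \<Rightarrow> 'a mat set" where
  "blow_up k l d X =
     {foldr (+) (map (\<lambda>(A, T). A \<otimes>\<^sub>k T) ps) (0\<^sub>m (k * d) (l * d)) | ps.
        set ps \<subseteq> X \<times> carrier_mat d d}"

text \<open>\<open>GREATEST\<close> is the maximum of the (infinite) set of quotients, not merely its supremum.\<close>

definition ncrk :: "nat \<Rightarrow> nat \<Rightarrow> 'a::field mat set \<Rightarrow> real" where
  "ncrk k l X =
     (GREATEST q. \<exists>d\<ge>1. q = real (max_rank (blow_up k l d X)) / real d)"


subsection \<open>The coordinate model is the exterior algebra\<close>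

text \<open>The product is bilinear and associative with unit $e_\emptyset$, vectors square to zero, and
  each $e_S$ is the increasing product of the $e_j$ with $j \in S$.\<close>

lemma wedge_add_left: "(\<lambda>S. x S + y S) \<and>\<^sub>e z = (\<lambda>S. (x \<and>\<^sub>e z) S + (y \<and>\<^sub>e z) S)"
  by (simp add: wedge_def algebra_simps sum.distrib)

lemma wedge_add_right: "x \<and>\<^sub>e (\<lambda>S. y S + z S) = (\<lambda>S. (x \<and>\<^sub>e y) S + (x \<and>\<^sub>e z) S)"
  by (simp add: wedge_def algebra_simps sum.distrib)

lemma wedge_smult_left: "(\<lambda>S. a * x S) \<and>\<^sub>e y = (\<lambda>S. a * (x \<and>\<^sub>e y) S)"
  by (simp add: wedge_def algebra_simps sum_distrib_left)

lemma wedge_smult_right: "x \<and>\<^sub>e (\<lambda>S. a * y S) = (\<lambda>S. a * (x \<and>\<^sub>e y) S)"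
  by (simp add: wedge_def algebra_simps sum_distrib_left)

lemma finite_inversions:
  assumes "finite T" "finite U"
  shows "finite {(t, u). t \<in> T \<and> u \<in> U \<and> u < (t::nat)}"
  by (rule finite_subset[of _ "T \<times> U"]) (use assms in auto)

lemma shuffle_sign_Un_left:
  assumes "finite T" "finite U" "finite W" "T \<inter> U = {}"
  shows "shuffle_sign (T \<union> U) W = shuffle_sign T W * (shuffle_sign U W :: 'a::comm_ring_1)"
proof -
  have "{(t, u). t \<in> T \<union> U \<and> u \<in> W \<and> u < t} =
        {(t, u). t \<in> T \<and> u \<in> W \<and> u < t} \<union> {(t, u). t \<in> U \<and> u \<in> W \<and> u < t}" by auto
  then have "card {(t, u). t \<in> T \<union> U \<and> u \<in> W \<and> u < t} =
        card {(t, u). t \<in> T \<and> u \<in> W \<and> u < t} + card {(t, u). t \<in> U \<and> u \<in> W \<and> u < t}"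
    using assms by (subst card_Un_disjoint[symmetric]) (auto intro: finite_inversions)
  then show ?thesis by (simp add: shuffle_sign_def power_add)
qed

lemma shuffle_sign_Un_right:
  assumes "finite T" "finite U" "finite W" "U \<inter> W = {}"
  shows "shuffle_sign T (U \<union> W) = shuffle_sign T U * (shuffle_sign T W :: 'a::comm_ring_1)"
proof -
  have "{(t, u). t \<in> T \<and> u \<in> U \<union> W \<and> u < t} =
        {(t, u). t \<in> T \<and> u \<in> U \<and> u < t} \<union> {(t, u). t \<in> T \<and> u \<in> W \<and> u < t}" by auto
  then have "card {(t, u). t \<in> T \<and> u \<in> U \<union> W \<and> u < t} =
        card {(t, u). t \<in> T \<and> u \<in> U \<and> u < t} + card {(t, u). t \<in> T \<and> u \<in> W \<and> u < t}"
    using assms by (subst card_Un_disjoint[symmetric]) (auto intro: finite_inversions)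
  then show ?thesis by (simp add: shuffle_sign_def power_add)
qed

lemma wedge_infinite: "infinite S \<Longrightarrow> (x \<and>\<^sub>e y) S = 0"
  by (simp add: wedge_def)

theorem wedge_assoc: "(x \<and>\<^sub>e y) \<and>\<^sub>e z = x \<and>\<^sub>e y \<and>\<^sub>e (z :: 'a::comm_ring_1 ext)"
proof
  fix S :: "nat set"
  show "((x \<and>\<^sub>e y) \<and>\<^sub>e z) S = (x \<and>\<^sub>e y \<and>\<^sub>e z) S"
  proof (cases "finite S")
    case False
    then show ?thesis by (simp add: wedge_infinite)
  next
    case fin: True
    let ?s = "shuffle_sign :: nat set \<Rightarrow> nat set \<Rightarrow> 'a"
    have fs: "finite A" if "A \<subseteq> S" for A using that fin by (rule finite_subset)
    have "((x \<and>\<^sub>e y) \<and>\<^sub>e z) S =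
        (\<Sum>(V, T) \<in> (SIGMA V:Pow S. Pow V).
           ?s V (S - V) * (?s T (V - T) * x T * y (V - T)) * z (S - V))"
      using fin fs by (subst sum.Sigma[symmetric]) 
        (auto simp: wedge_def sum_distrib_left sum_distrib_right)
    also have "\<dots> = (\<Sum>(T, U) \<in> (SIGMA T:Pow S. Pow (S - T)).
           ?s T (S - T) * x T * (?s U (S - T - U) * y U * z (S - T - U)))"
    proof (rule sum.reindex_bij_witness[where i = "\<lambda>(T, U). (T \<union> U, T)" and j = "\<lambda>(V, T). (T, V - T)"],
        goal_cases)
      case (5 p)
      then obtain V T where p: "p = (V, T)" "V \<subseteq> S" "T \<subseteq> V" by auto
      let ?U = "V - T" and ?W = "S - V"
      have "finite T" "finite ?U" "finite ?W" using p fs by auto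
      moreover have "V = T \<union> ?U" "S - T = ?U \<union> ?W" "S - T - ?U = ?W" using p by auto
      moreover have "?s (T \<union> ?U) ?W = ?s T ?W * ?s ?U ?W"
        by (rule shuffle_sign_Un_left) (use calculation in auto)
      moreover have "?s T (?U \<union> ?W) = ?s T ?U * ?s T ?W"
        by (rule shuffle_sign_Un_right) (use calculation in auto)
      ultimately show ?case using p(1) by (simp add: algebra_simps)
    qed auto
    also have "\<dots> = (x \<and>\<^sub>e y \<and>\<^sub>e z) S"
      using fin fs by (subst sum.Sigma[symmetric]) (auto simp: wedge_def sum_distrib_left)
    finally show ?thesis .
  qed
qed

lemma wedge_ext_basis:
  assumes "finite T" "finite U"
  shows "ext_basis T \<and>\<^sub>e ext_basis U =
    (\<lambda>S. if T \<inter> U = {} then shuffle_sign T U * ext_basis (T \<union> U) S else (0 :: 'a::comm_ring_1))"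
proof
  fix S :: "nat set"
  show "(ext_basis T \<and>\<^sub>e ext_basis U) S =
    (if T \<inter> U = {} then shuffle_sign T U * ext_basis (T \<union> U) S else (0 :: 'a))"
  proof (cases "finite S")
    case False
    then show ?thesis using assms by (auto simp: wedge_infinite ext_basis_def)
  next
    case True
    have "(ext_basis T \<and>\<^sub>e ext_basis U) S =
        (\<Sum>V\<in>Pow S. if V = T then shuffle_sign T (S - T) * (ext_basis U (S - T) :: 'a) else 0)"
      unfolding wedge_def by (rule sum.cong) (auto simp: ext_basis_def)
    also have "\<dots> = (if T \<subseteq> S \<and> S - T = U then shuffle_sign T U else 0)"
      using True by (simp add: ext_basis_def)
    also have "\<dots> = (if T \<inter> U = {} then shuffle_sign T U * ext_basis (T \<union> U) S else 0)"
    proof -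
      have "T \<subseteq> S \<and> S - T = U \<longleftrightarrow> T \<inter> U = {} \<and> S = T \<union> U" by auto
      then show ?thesis by (simp add: ext_basis_def)
    qed
    finally show ?thesis .
  qed
qed

lemma ext_basis_insert:
  assumes "finite S" "\<And>s. s \<in> S \<Longrightarrow> j < s"
  shows "ext_basis {j} \<and>\<^sub>e ext_basis S = (ext_basis (insert j S) :: 'a::comm_ring_1 ext)"
proof -
  have no_inv: "{(t, u). t \<in> {j} \<and> u \<in> S \<and> u < t} = {}" using assms by force
  have "shuffle_sign {j} S = (1 :: 'a)" unfolding shuffle_sign_def no_inv by simp
  moreover have "j \<notin> S" using assms by force
  ultimately show ?thesis using assms by (simp add: wedge_ext_basis)
qed

lemma wedge_one:
  assumes "\<And>S. infinite S \<Longrightarrow> x S = (0 :: 'a::comm_ring_1)"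
  shows "ext_basis {} \<and>\<^sub>e x = x" "x \<and>\<^sub>e ext_basis {} = x"
proof -
  have sign: "shuffle_sign T {} = (1 :: 'a)" "shuffle_sign {} T = (1 :: 'a)" for T
    by (simp_all add: shuffle_sign_def)
  show "ext_basis {} \<and>\<^sub>e x = x"
  proof
    fix S
    have "(ext_basis {} \<and>\<^sub>e x) S = (\<Sum>T\<in>Pow S. if T = {} then x S else 0)"
      unfolding wedge_def by (rule sum.cong) (auto simp: ext_basis_def sign)
    then show "(ext_basis {} \<and>\<^sub>e x) S = x S" using assms by (cases "finite S") auto
  qed
  show "x \<and>\<^sub>e ext_basis {} = x"
  proof
    fix S
    have "(x \<and>\<^sub>e ext_basis {}) S = (\<Sum>T\<in>Pow S. if T = S then x S else 0)"
      unfolding wedge_def by (rule sum.cong) (auto simp: ext_basis_def sign)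
    then show "(x \<and>\<^sub>e ext_basis {}) S = x S" using assms by (cases "finite S") auto
  qed
qed

lemma ext_vec_add:
  "v \<in> carrier_vec n \<Longrightarrow> w \<in> carrier_vec n \<Longrightarrow>
     ext_vec (v + w) = (\<lambda>S. ext_vec v S + ext_vec w S)"
  by (auto simp: ext_vec_def algebra_simps sum.distrib)

lemma ext_vec_smult: "ext_vec (a \<cdot>\<^sub>v v) = (\<lambda>S. a * ext_vec v S)"
  by (auto simp: ext_vec_def algebra_simps sum_distrib_left)

lemma wedge_ext_vec_ext_vec: "ext_vec v \<and>\<^sub>e ext_vec v = (\<lambda>S. 0 :: 'a::comm_ring_1)"
proof
  fix S :: "nat set"
  let ?w = "\<lambda>j k. (ext_basis {j} \<and>\<^sub>e ext_basis {k}) S :: 'a"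
  let ?n = "dim_vec v"
  have sq: "?w j j = 0" for j by (simp add: wedge_ext_basis)
  have sgn: "shuffle_sign {k} {j} = - (shuffle_sign {j} {k} :: 'a)" if "j < k" for j k
  proof -
    have 1: "{(t, u). t \<in> {k} \<and> u \<in> {j} \<and> u < t} = {(k, j)}" using that by auto
    have 2: "{(t, u). t \<in> {j} \<and> u \<in> {k} \<and> u < t} = {}" using that by auto
    show ?thesis unfolding shuffle_sign_def 1 2 by simp
  qed
  have anti: "?w k j = - ?w j k" if "j < k" for j k
    using that sgn[OF that] by (simp add: wedge_ext_basis insert_commute)
  have "(ext_vec v \<and>\<^sub>e ext_vec v) S = (\<Sum>T\<in>Pow S. \<Sum>j<?n. \<Sum>k<?n. v $ j * v $ k *
           (shuffle_sign T (S - T) * ext_basis {j} T * ext_basis {k} (S - T)))"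
    by (simp add: wedge_def ext_vec_def sum_distrib_left sum_distrib_right algebra_simps)
  also have "\<dots> = (\<Sum>j<?n. \<Sum>k<?n. v $ j * v $ k * ?w j k)"
    unfolding wedge_def sum_distrib_left
    by (subst sum.swap, rule sum.cong[OF refl], rule sum.swap)
  also have "\<dots> = 0"
  proof -
    have "(\<Sum>j<m. \<Sum>k<m. v $ j * v $ k * ?w j k) = 0" for m
    proof (induction m)
      case (Suc m)
      have "(\<Sum>k<m. v $ m * v $ k * ?w m k) = - (\<Sum>j<m. v $ j * v $ m * ?w j m)"
        unfolding sum_negf[symmetric] by (rule sum.cong) (auto simp: anti algebra_simps)
      then show ?case using Suc by (simp add: sum.distrib sq)
    qed simp
    then show ?thesis .
  qed
  finally show "(ext_vec v \<and>\<^sub>e ext_vec v) S = 0" .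
qed

lemma wedge_ext_power:
  assumes "x \<in> ext_power i n" "y \<in> ext_power j n"
  shows "x \<and>\<^sub>e y \<in> ext_power (i + j) n"
  unfolding ext_power_def
proof (intro CollectI allI impI)
  fix S assume "(x \<and>\<^sub>e y) S \<noteq> 0"
  then obtain T where T: "T \<subseteq> S" "x T \<noteq> 0" "y (S - T) \<noteq> 0"
    unfolding wedge_def
    by (smt (verit) PowD mult_not_zero sum.not_neutral_contains_not_neutral)
  have T': "T \<subseteq> {..<n}" "card T = i" "S - T \<subseteq> {..<n}" "card (S - T) = j"
    using assms T unfolding ext_power_def by auto
  have "card (T \<union> (S - T)) = i + j"
    using T' by (subst card_Un_disjoint) (auto intro: finite_subset)
  then show "S \<subseteq> {..<n} \<and> card S = i + j" using T T' by (auto simp: Un_absorb1)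
qed

lemma ext_vec_ext_power: "v \<in> carrier_vec n \<Longrightarrow> ext_vec v \<in> ext_power 1 n"
  unfolding ext_power_def ext_vec_def
  by (auto simp: ext_basis_def elim!: sum.not_neutral_contains_not_neutral split: if_splits)

lemma left_wedge_ext_power:
  "v \<in> carrier_vec n \<Longrightarrow> x \<in> ext_power i n \<Longrightarrow> left_wedge v x \<in> ext_power (i + 1) n"
  unfolding left_wedge_def using wedge_ext_power[OF ext_vec_ext_power, of v n x i] by simp


subsection \<open>Coordinates\<close>

lemma set_ksubsets: "set (ksubsets i n) = {S. S \<subseteq> {..<n} \<and> card S = i}"
proof -
  have len: "length xs = card (set xs)" if "xs \<in> set (subseqs [0..<n])" for xs
    using subseqs_distinctD[OF that] by (simp add: distinct_card)
  have "set (ksubsets i n) = {S \<in> set ` set (subseqs [0..<n]). card S = i}"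
    unfolding ksubsets_def using len by auto
  then show ?thesis by (auto simp: subseqs_powset atLeast0LessThan)
qed

lemma distinct_ksubsets: "distinct (ksubsets i n)"
  unfolding ksubsets_def
  using distinct_set_subseqs[of "[0..<n]"] by (auto simp: distinct_map intro: inj_on_subset)

lemma length_ksubsets: "length (ksubsets i n) = n choose i"
  using distinct_card[OF distinct_ksubsets[of i n]]
  by (simp add: set_ksubsets n_subsets)

lemma ext_matrix_mult_coords:
  fixes F :: "'a::comm_ring_1 ext \<Rightarrow> 'a ext"
  assumes add: "\<And>x y. F (\<lambda>S. x S + y S) = (\<lambda>S. F x S + F y S)"
    and smult: "\<And>a x. F (\<lambda>S. a * x S) = (\<lambda>S. a * F x S)"
    and x: "x \<in> ext_power i n"
  shows "ext_matrix i j n F *\<^sub>v ext_coords i n x = ext_coords j n (F x)"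
proof (rule eq_vecI)
  let ?B = "ksubsets i n"
  have zero: "F (\<lambda>S. 0) = (\<lambda>S. 0)" using smult[of 0 "\<lambda>S. 0"] by simp
  have lin: "F (\<lambda>S. \<Sum>c\<in>C. a c * b c S) = (\<lambda>S. \<Sum>c\<in>C. a c * F (b c) S)"
    if "finite C" for C :: "nat set" and a b
    using that by induction (simp_all add: zero add smult)
  have "x = (\<lambda>S. \<Sum>c\<in>{0..<n choose i}. x (?B ! c) * ext_basis (?B ! c) S)"
  proof
    fix S
    have "(\<Sum>c\<in>{0..<n choose i}. x (?B ! c) * ext_basis (?B ! c) S) =
        (\<Sum>T\<in>set ?B. x T * ext_basis T S)"
      by (rule sum.reindex_bij_betw[of "(!) ?B"])
        (simp add: bij_betw_nth distinct_ksubsets length_ksubsets atLeast0LessThan)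
    also have "\<dots> = (\<Sum>T\<in>set ?B. if S = T then x T else 0)"
      by (rule sum.cong) (auto simp: ext_basis_def)
    also have "\<dots> = x S"
      using x by (auto simp: set_ksubsets ext_power_def)
    finally show "x S = (\<Sum>c\<in>{0..<n choose i}. x (?B ! c) * ext_basis (?B ! c) S)" ..
  qed
  then have "F x = F (\<lambda>S. \<Sum>c\<in>{0..<n choose i}. x (?B ! c) * ext_basis (?B ! c) S)"
    by (rule arg_cong)
  also have "\<dots> = (\<lambda>S. \<Sum>c\<in>{0..<n choose i}. x (?B ! c) * F (ext_basis (?B ! c)) S)"
    by (rule lin) simp
  finally have Fx: "F x = (\<lambda>S. \<Sum>c\<in>{0..<n choose i}. x (?B ! c) * F (ext_basis (?B ! c)) S)" .
  fix r assume "r < dim_vec (ext_coords j n (F x))"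
  then have r: "r < n choose j" by (simp add: ext_coords_def)
  then have "(ext_matrix i j n F *\<^sub>v ext_coords i n x) $ r =
      (\<Sum>c\<in>{0..<n choose i}. F (ext_basis (?B ! c)) (ksubsets j n ! r) * x (?B ! c))"
    by (simp add: ext_coords_def ext_matrix_def scalar_prod_def)
  also have "\<dots> = F x (ksubsets j n ! r)"
    unfolding fun_cong[OF Fx, of "ksubsets j n ! r"] by (rule sum.cong) (simp_all add: mult.commute)
  finally show "(ext_matrix i j n F *\<^sub>v ext_coords i n x) $ r = ext_coords j n (F x) $ r"
    using r by (simp add: ext_coords_def)
qed (simp add: ext_coords_def ext_matrix_def)

end

theory Submission
  imports Defs
begin

text \<open>
  \<^bold>\<open>Full non-commutative rank.\<close> It suffices to find square matrices $T_1, \dots, T_n$ of some size $d$ such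
  that $D = \sum_j L_{e_j} \otimes T_j$ has the largest rank that its format permits. Take $d = 2^n$ and let
  $T_j$ be Clifford generators on the space of spinors, which has a basis $f_U$ indexed by the
  subsets $U$ of $\{0, \dots, n-1\}$: $T_j f_U = \pm f_{U \triangle \{j\}}$, with the same sign as in
  $e_j \wedge e_S = \pm e_{S \cup \{j\}}$, namely the parity of the number of elements below $j$. Then $D$ maps
  $e_S \otimes f_U$ to a signed sum of the $e_{S \cup \{j\}} \otimes f_{U \triangle \{j\}}$ with $j \notin S$, so it
  preserves $V = S \triangle U$ and splits into one block for each $V$. The two signs multiply to a sign that
  depends only on $j$ and $V$ (\<open>spin_sign_block\<close>), and a rescaling of the basis vectors by $\pm 1$ removes
  it. What is left in each block is the inclusion matrix between the $i$-subsets and the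
  $(i+1)$-subsets of an $n$-set. In characteristic 0 it has full rank, by a double count
  (\<open>up_operator_kernel_trivial\<close> for $2i < n$, and \<open>down_operator_kernel_trivial\<close> for the other $i$,
  by complementation). Thus the anticommutativity of the exterior algebra, which keeps the rank of a
  single $L_v$ small, is cancelled by that of the Clifford algebra.

  \<^bold>\<open>Deficient rank.\<close> Since $v \wedge v = 0$, the image of $L_v$ in one degree lies in the kernel of $L_v$
  in the next. For $0 < i < n - 1$ the maps $L_v$ in degrees $i - 1$ and $i + 1$ are nonzero if $v \neq 0$, so
  $L_v$ in degree $i$ is neither injective nor surjective.
\<close>

section \<open>Rank and kernels\<close>

context vec_space
begin

text \<open>Maximality does the work: a column outside the span of a maximal independent set of columns
  could be added to it.\<close>

lemma basis_among_cols:
  assumes "A \<in> carrier_mat n nc"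
  obtains S where "S \<subseteq> set (cols A)" "lin_indpt S" "card S = rank A" "set (cols A) \<subseteq> span S"
proof -
  have cols: "set (cols A) \<subseteq> carrier_vec n"
    using assms cols_dim by blast
  obtain S where S: "maximal S (\<lambda>T. T \<subseteq> set (cols A) \<and> lin_indpt T)"
    using maximal_exists_superset[of "set (cols A)" "\<lambda>T. T \<subseteq> set (cols A) \<and> lin_indpt T" "{}"]
    by (auto simp: finite_lin_indpt2)
  have "v \<in> span S" if "v \<in> set (cols A)" for v
  proof (rule ccontr)
    assume v: "v \<notin> span S"
    have sub: "S \<subseteq> carrier_vec n" "S \<subseteq> set (cols A)" "lin_indpt S"
      using S cols by (auto simp: maximal_def)
    then have "v \<notin> S" using v span_mem by auto
    moreover have "lin_indpt (insert v S)"
      using lin_dep_iff_in_span[of S v] sub v \<open>v \<notin> S\<close> that cols by auto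
    ultimately show False
      using S sub that unfolding maximal_def by blast
  qed
  with S rank_card_indpt[OF assms S] show ?thesis
    by (intro that[of S]) (auto simp: maximal_def)
qed

lemma rank_le_nr:
  assumes "A \<in> carrier_mat n nc"
  shows "rank A \<le> n"
proof -
  obtain S where S: "S \<subseteq> set (cols A)" "lin_indpt S" "card S = rank A"
    using basis_among_cols[OF assms] by metis
  have "S \<subseteq> carrier_vec n" using S assms cols_dim by blast
  with S show ?thesis using li_le_dim(2)[of S] fin_dim dim_is_n by auto
qed

text \<open>Lets a vector orthogonal to some columns be tested on a basis only; both directions of the next
  criterion for row rank use it.\<close>

lemma scalar_prod_span_zero:
  assumes w: "w \<in> carrier_vec n" and S: "S \<subseteq> carrier_vec n"
    and ortho: "\<And>s. s \<in> S \<Longrightarrow> w \<bullet> s = 0" and v: "v \<in> span S"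
  shows "w \<bullet> v = 0"
proof -
  obtain a T where T: "finite T" "T \<subseteq> S" and v: "v = lincomb a T"
    using v S unfolding span_def by auto
  have "w \<bullet> lincomb a T = (\<Sum>s\<in>T. a s * (w \<bullet> s))"
  proof -
    have "w \<bullet> lincomb a T = (\<Sum>k<n. w $ k * (\<Sum>s\<in>T. a s * s $ k))"
      using T S by (auto simp: scalar_prod_def lincomb_index atLeast0LessThan intro!: sum.cong)
    also have "\<dots> = (\<Sum>s\<in>T. \<Sum>k<n. a s * (w $ k * s $ k))"
      by (subst sum.swap) (simp add: sum_distrib_left mult_ac)
    also have "\<dots> = (\<Sum>s\<in>T. a s * (w \<bullet> s))"
      using T S by (auto simp: scalar_prod_def sum_distrib_left atLeast0LessThan intro!: sum.cong)
    finally show ?thesis .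
  qed
  also have "\<dots> = 0" using T ortho by (auto intro!: sum.neutral)
  finally show ?thesis using v by simp
qed

text \<open>The rank is the dimension of the column span, so deficiency means that this span is a proper
  subspace, and a proper subspace is contained in a hyperplane. The normal vector of such a hyperplane
  is found as a kernel vector of a square matrix.\<close>

lemma rank_less_nr_iff:
  assumes A: "A \<in> carrier_mat n nc"
  shows "rank A < n \<longleftrightarrow>
    (\<exists>w \<in> carrier_vec n. w \<noteq> 0\<^sub>v n \<and> (\<forall>c<nc. w \<bullet> col A c = 0))"
proof
  obtain S where S: "S \<subseteq> set (cols A)" "lin_indpt S" "card S = rank A" "set (cols A) \<subseteq> span S"
    using basis_among_cols[OF A] .
  have colsA: "set (cols A) \<subseteq> carrier_vec n" using A cols_dim by blast
  have SV: "S \<subseteq> carrier_vec n" and finS: "finite S"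
    using S(1) colsA finite_subset[OF S(1)] by auto
  {
    assume less: "rank A < n"
    obtain ss where ss: "set ss = S" "distinct ss" using finite_distinct_list[OF finS] by blast
    \<comment> \<open>A basis of the column span as the rows of a square matrix; there are too few of them, so at
      least one zero row is added and the matrix is singular.\<close>
    define M where "M = mat_of_rows n (ss @ replicate (n - length ss) (0\<^sub>v n))"
    have len: "length ss < n" using less S(3) ss distinct_card by metis
    have M: "M \<in> carrier_mat n n" unfolding M_def using len by (auto simp: mat_of_rows_def)
    have row: "row M k = (if k < length ss then ss ! k else 0\<^sub>v n)" if "k < n" for k
      using that len ss SV nth_mem unfolding M_def
      by (subst mat_of_rows_row) (auto simp: nth_append)
    have "M\<^sup>T *\<^sub>v unit_vec n (length ss) = 0\<^sub>v n"
    proof (rule eq_vecI)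
      fix k assume k: "k < dim_vec (0\<^sub>v n :: 'a vec)"
      then have "(M\<^sup>T *\<^sub>v unit_vec n (length ss)) $ k = row M (length ss) $ k"
        using M len by (simp add: scalar_prod_right_unit[where n = n])
      also have "\<dots> = 0\<^sub>v n $ k" using row[OF len] by simp
      finally show "(M\<^sup>T *\<^sub>v unit_vec n (length ss)) $ k = 0\<^sub>v n $ k" .
    qed (use M in simp)
    moreover have "unit_vec n (length ss) \<noteq> (0\<^sub>v n :: 'a vec)"
      using len by (simp add: unit_vec_nonzero)
    ultimately have "det M\<^sup>T = 0"
      using det_0_iff_vec_prod_zero_field[of "M\<^sup>T" n] M by (meson transpose_carrier_mat unit_vec_carrier)
    then have "det M = 0" using det_transpose[OF M] by simp
    then obtain w where w: "w \<in> carrier_vec n" "w \<noteq> 0\<^sub>v n" "M *\<^sub>v w = 0\<^sub>v n"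
      using det_0_iff_vec_prod_zero_field[OF M] by blast
    have "w \<bullet> s = 0" if s: "s \<in> S" for s
    proof -
      obtain k where k: "k < length ss" "s = ss ! k"
        using s ss(1) by (auto simp: in_set_conv_nth)
      then have "s \<bullet> w = (M *\<^sub>v w) $ k" using row[of k] len M by simp
      then have "s \<bullet> w = 0" using w(3) k len by simp
      then show ?thesis using comm_scalar_prod[of s n w] s SV w(1) by auto
    qed
    then have "w \<bullet> v = 0" if "v \<in> span S" for v
      using scalar_prod_span_zero[OF w(1) SV] that by blast
    moreover have "col A c \<in> span S" if "c < nc" for c
      using S(4) that A by (auto simp: cols_def)
    ultimately show "\<exists>w \<in> carrier_vec n. w \<noteq> 0\<^sub>v n \<and> (\<forall>c<nc. w \<bullet> col A c = 0)"
      using w by blast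
  }
  {
    assume "\<exists>w \<in> carrier_vec n. w \<noteq> 0\<^sub>v n \<and> (\<forall>c<nc. w \<bullet> col A c = 0)"
    then obtain w where w: "w \<in> carrier_vec n" "w \<noteq> 0\<^sub>v n" "\<And>c. c < nc \<Longrightarrow> w \<bullet> col A c = 0"
      by blast
    have "rank A \<noteq> n"
    proof
      assume "rank A = n"
      then have "basis S" using dim_li_is_basis[of S] S SV finS fin_dim dim_is_n by auto
      then have span: "span S = carrier_vec n" by (simp add: basis_def)
      have "w \<bullet> s = 0" if "s \<in> S" for s
      proof -
        have "s \<in> set (cols A)" using S that by auto
        then obtain c where "c < nc" "s = col A c" using A by (auto simp: in_set_conv_nth)
        then show ?thesis using w by simp
      qed
      then have "w \<bullet> unit_vec n k = 0" if "k < n" for k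
        using scalar_prod_span_zero[OF w(1) SV, of "unit_vec n k"] span by auto
      then have "w = 0\<^sub>v n" using w(1) by (auto simp: vec_eq_iff)
      with w show False by simp
    qed
    then show "rank A < n" using rank_le_nr[OF A] by simp
  }
qed

text \<open>Linear dependence is a property of the set of columns, which forgets repetitions. So equal columns
  are treated separately: the difference of two unit vectors is then in the kernel.\<close>

lemma rank_less_nc_iff:
  assumes A: "A \<in> carrier_mat n nc"
  shows "rank A < nc \<longleftrightarrow> (\<exists>v \<in> carrier_vec nc. v \<noteq> 0\<^sub>v nc \<and> A *\<^sub>v v = 0\<^sub>v n)"
proof (cases "distinct (cols A)")
  case True
  have "rank A < nc \<longleftrightarrow> lin_dep (set (cols A))"
    using lin_indpt_full_rank[OF A True] full_rank_lin_indpt[OF A _ True] rank_le_nc[OF A]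
    by fastforce
  then show ?thesis using lin_depI[OF A _ _ _ True] lin_depE[OF A _ True] by metis
next
  case False
  obtain S where S: "S \<subseteq> set (cols A)" "card S = rank A"
    using basis_among_cols[OF A] by metis
  have "rank A \<le> card (set (cols A))" using S by (metis List.finite_set card_mono)
  also have "\<dots> < nc" using False A card_distinct[of "cols A"] card_length[of "cols A"] 
    by (auto simp: le_less)
  finally have "rank A < nc" .
  moreover obtain c d where cd: "c < nc" "d < nc" "c \<noteq> d" "col A c = col A d"
    using False A by (auto simp: distinct_conv_nth)
  define v :: "'a vec" where "v = unit_vec nc c - unit_vec nc d"
  have "v $ c = 1" using cd by (simp add: v_def)
  then have "v \<noteq> 0\<^sub>v nc" using cd by auto
  moreover have "A *\<^sub>v v = col A c - col A d"
    using A cd(1,2)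
    by (intro eq_vecI) (auto simp: v_def scalar_prod_minus_distrib[where n = nc]
        scalar_prod_right_unit[where n = nc])
  then have "A *\<^sub>v v = 0\<^sub>v n"
    using cd(2,4) A by (auto intro: eq_vecI)
  moreover have "v \<in> carrier_vec nc" by (simp add: v_def)
  ultimately show ?thesis by blast
qed

end

text \<open>Replaces the numbering of rows and columns by arbitrary index sets, so that the kernel can be
  computed with functions on sets of pairs instead of vectors.\<close>

lemma rank_eq_dim_col_labelled:
  fixes A :: "'a::field mat"
  assumes A: "A \<in> carrier_mat a b"
    and g: "bij_betw g {..<a} P" and h: "bij_betw h {..<b} Q"
    and entry: "\<And>r c. r < a \<Longrightarrow> c < b \<Longrightarrow> A $$ (r, c) = E (g r) (h c)"
    and ker: "\<And>x q. (\<And>p. p \<in> P \<Longrightarrow> (\<Sum>q\<in>Q. E p q * x q) = 0) \<Longrightarrow> q \<in> Q \<Longrightarrow> x q = 0"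
  shows "vec_space.rank a A = b"
proof (rule ccontr)
  assume "vec_space.rank a A \<noteq> b"
  then obtain v where v: "v \<in> carrier_vec b" "v \<noteq> 0\<^sub>v b" "A *\<^sub>v v = 0\<^sub>v a"
    using vec_space.rank_less_nc_iff[OF A] vec_space.rank_le_nc[OF A] by force
  define x where "x q = v $ (inv_into {..<b} h q)" for q
  have x: "x (h c) = v $ c" if "c < b" for c
    using that h by (simp add: x_def bij_betw_inv_into_left)
  have row: "(\<Sum>q\<in>Q. E p q * x q) = 0" if p: "p \<in> P" for p
  proof -
    obtain r where r: "r < a" "p = g r"
      using p bij_betw_imp_surj_on[OF g] by blast
    have "(\<Sum>q\<in>Q. E p q * x q) = (\<Sum>c<b. E p (h c) * x (h c))"
      by (rule sum.reindex_bij_betw[OF h, symmetric])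
    also have "\<dots> = (A *\<^sub>v v) $ r"
      using A v(1) r entry x by (auto simp: scalar_prod_def atLeast0LessThan intro!: sum.cong)
    also have "\<dots> = 0" using v(3) r by simp
    finally show ?thesis .
  qed
  have "v $ c = 0" if "c < b" for c
    using ker[OF row, of "h c"] x that h by (auto simp: bij_betw_def)
  then show False using v by (auto simp: vec_eq_iff)
qed

lemma rank_eq_dim_row_labelled:
  fixes A :: "'a::field mat"
  assumes A: "A \<in> carrier_mat a b"
    and g: "bij_betw g {..<a} P" and h: "bij_betw h {..<b} Q"
    and entry: "\<And>r c. r < a \<Longrightarrow> c < b \<Longrightarrow> A $$ (r, c) = E (g r) (h c)"
    and ker: "\<And>x p. (\<And>q. q \<in> Q \<Longrightarrow> (\<Sum>p\<in>P. E p q * x p) = 0) \<Longrightarrow> p \<in> P \<Longrightarrow> x p = 0"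
  shows "vec_space.rank a A = a"
proof (rule ccontr)
  assume "vec_space.rank a A \<noteq> a"
  then obtain v where v: "v \<in> carrier_vec a" "v \<noteq> 0\<^sub>v a" "\<And>c. c < b \<Longrightarrow> v \<bullet> col A c = 0"
    using vec_space.rank_less_nr_iff[OF A] vec_space.rank_le_nr[OF A] by force
  define x where "x p = v $ (inv_into {..<a} g p)" for p
  have x: "x (g r) = v $ r" if "r < a" for r
    using that g by (simp add: x_def bij_betw_inv_into_left)
  have col: "(\<Sum>p\<in>P. E p q * x p) = 0" if q: "q \<in> Q" for q
  proof -
    obtain c where c: "c < b" "q = h c"
      using q bij_betw_imp_surj_on[OF h] by blast
    have "(\<Sum>p\<in>P. E p q * x p) = (\<Sum>r<a. E (g r) q * x (g r))"
      by (rule sum.reindex_bij_betw[OF g, symmetric])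
    also have "\<dots> = v \<bullet> col A c"
      using A v(1) c entry x by (auto simp: scalar_prod_def atLeast0LessThan intro!: sum.cong)
    also have "\<dots> = 0" using v(3) c by simp
    finally show ?thesis .
  qed
  have "v $ r = 0" if "r < a" for r
    using ker[OF col, of "g r"] x that g by (auto simp: bij_betw_def)
  then show False using v by (auto simp: vec_eq_iff)
qed

section \<open>Blow-ups and non-commutative rank\<close>

lemma foldr_plus_mat:
  assumes "set Bs \<subseteq> carrier_mat a b"
  shows "foldr (+) Bs (0\<^sub>m a b) \<in> carrier_mat a b"
    and "r < a \<Longrightarrow> c < b \<Longrightarrow> foldr (+) Bs (0\<^sub>m a b) $$ (r, c) = (\<Sum>B\<leftarrow>Bs. (B :: 'a::comm_ring_1 mat) $$ (r, c))"
proof -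
  have "foldr (+) Bs (0\<^sub>m a b) \<in> carrier_mat a b \<and>
     (r < a \<longrightarrow> c < b \<longrightarrow> foldr (+) Bs (0\<^sub>m a b) $$ (r, c) = (\<Sum>B\<leftarrow>Bs. B $$ (r, c)))"
    using assms by (induction Bs) auto
  then show "foldr (+) Bs (0\<^sub>m a b) \<in> carrier_mat a b"
    and "r < a \<Longrightarrow> c < b \<Longrightarrow> foldr (+) Bs (0\<^sub>m a b) $$ (r, c) = (\<Sum>B\<leftarrow>Bs. B $$ (r, c))"
    by auto
qed

lemma kronecker_carrier:
  assumes "A \<in> carrier_mat k l" "B \<in> carrier_mat a b"
  shows "A \<otimes>\<^sub>k B \<in> carrier_mat (k * a) (l * b)"
  unfolding kronecker_def carrier_matD[OF assms(1)] carrier_matD[OF assms(2)] by (rule mat_carrier)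

lemma blow_up_carrier:
  assumes "X \<subseteq> carrier_mat k l"
  shows "blow_up k l d X \<subseteq> carrier_mat (k * d) (l * d)"
proof
  fix B assume "B \<in> blow_up k l d X"
  then obtain ps where B: "B = foldr (+) (map (\<lambda>(A, T). A \<otimes>\<^sub>k T) ps) (0\<^sub>m (k * d) (l * d))"
    and ps: "set ps \<subseteq> X \<times> carrier_mat d d"
    unfolding blow_up_def by blast
  have "set (map (\<lambda>(A, T). A \<otimes>\<^sub>k T) ps) \<subseteq> carrier_mat (k * d) (l * d)"
    using ps assms by (auto intro!: kronecker_carrier)
  then show "B \<in> carrier_mat (k * d) (l * d)"
    unfolding B by (rule foldr_plus_mat(1))
qed

lemma blow_up_nonempty: "blow_up k l d X \<noteq> {}"
  unfolding blow_up_def by (auto intro!: exI[of _ "[]"])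

lemma max_rank_attained:
  assumes "X \<subseteq> carrier_mat a b" "X \<noteq> {}"
  shows "\<exists>A\<in>X. max_rank X = vec_space.rank a A"
    and "A \<in> X \<Longrightarrow> vec_space.rank a A \<le> max_rank X"
proof -
  let ?r = "\<lambda>A. vec_space.rank (dim_row A) A"
  have r: "?r A = vec_space.rank a A" "vec_space.rank a A \<le> b" if "A \<in> X" for A
    using that assms vec_space.rank_le_nc[of A a b] by auto
  have fin: "finite (?r ` X)"
    by (rule finite_subset[of _ "{..b}"]) (use r in auto)
  have "max_rank X \<in> ?r ` X"
    unfolding max_rank_def using fin assms by (intro Max_in) auto
  then show "\<exists>A\<in>X. max_rank X = vec_space.rank a A" using r by auto
  show "vec_space.rank a A \<le> max_rank X" if "A \<in> X"
    using Max_ge[OF fin, of "?r A"] r that by (auto simp: max_rank_def)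
qed

lemma max_rank_le:
  assumes "X \<subseteq> carrier_mat a b" "X \<noteq> {}"
  shows "max_rank X \<le> min a b"
proof -
  obtain A where "A \<in> X" "max_rank X = vec_space.rank a A" using max_rank_attained(1)[OF assms] by blast
  then show ?thesis
    using assms vec_space.rank_le_nc[of A a b] vec_space.rank_le_nr[of A a b] by auto
qed

text \<open>Every quotient in the definition is at most the smaller dimension, so one matrix of full rank in one
  blow-up decides the maximum.\<close>

lemma ncrk_eq_min:
  assumes X: "X \<subseteq> carrier_mat k l" and d: "d \<ge> 1"
    and B: "B \<in> blow_up k l d X" and full: "vec_space.rank (k * d) B = min k l * d"
  shows "ncrk k l X = real (min k l)"
  unfolding ncrk_def
proof (rule Greatest_equality)
  have "max_rank (blow_up k l d X) = min k l * d"
    using max_rank_attained(2)[OF blow_up_carrier[OF X] blow_up_nonempty B]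
      max_rank_le[OF blow_up_carrier[OF X] blow_up_nonempty, of d] full
    by (auto simp: min_def split: if_splits)
  then show "\<exists>d\<ge>1. real (min k l) = real (max_rank (blow_up k l d X)) / real d"
    using d by (intro exI[of _ d]) simp
  fix q assume "\<exists>d\<ge>1. q = real (max_rank (blow_up k l d X)) / real d"
  then obtain d where d: "d \<ge> 1" "q = real (max_rank (blow_up k l d X)) / real d" by blast
  have "max_rank (blow_up k l d X) \<le> min k l * d"
    using max_rank_le[OF blow_up_carrier[OF X] blow_up_nonempty, of d]
    by (auto simp: min_def split: if_splits)
  then have "real (max_rank (blow_up k l d X)) \<le> real (min k l) * real d"
    by (simp flip: of_nat_mult)
  then show "q \<le> real (min k l)" using d by (simp add: divide_le_eq)
qed

section \<open>Inclusion matrices of subsets\<close>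

text \<open>The inclusion matrix between the \<open>k\<close>-subsets and the \<open>k + 1\<close>-subsets of $X$ has independent columns
  if $2k < |X|$ (Gottlieb). Fix $A$ and let $f_t$ be the sum of $y(B)$ over the \<open>k\<close>-subsets $B$ with
  $|B \cap A| = t$. Adding the hypothesis over all $C$ with $|C \cap A| = t$ and counting how often each
  $y(B)$ occurs gives $(k + 1 - t) f_{t-1} + (|X| - 2k + t) f_t = 0$, with $f_{-1} = 0$. The second coefficient is positive,
  so in characteristic 0 all $f_t$ vanish, one after the other, and $f_k = y(A)$.\<close>

lemma up_operator_kernel_trivial:
  fixes y :: "'b set \<Rightarrow> 'a::field_char_0"
  assumes X: "finite X" and k: "2 * k < card X"
    and ker: "\<And>C. C \<subseteq> X \<Longrightarrow> card C = Suc k \<Longrightarrow> (\<Sum>j\<in>C. y (C - {j})) = 0"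
    and A: "A \<subseteq> X" "card A = k"
  shows "y A = 0"
proof -
  define F where "F t = {B. B \<subseteq> X \<and> card B = k \<and> card (B \<inter> A) = t}" for t
  define G where "G t = {C. C \<subseteq> X \<and> card C = Suc k \<and> card (C \<inter> A) = t}" for t
  \<comment> \<open>This is the family \<open>F (t - 1)\<close>, but empty for \<open>t = 0\<close>.\<close>
  define F' where "F' t = {B. B \<subseteq> X \<and> card B = k \<and> Suc (card (B \<inter> A)) = t}" for t
  have fin: "finite B" if "B \<subseteq> X" for B using that X finite_subset by blast
  have finFG: "finite (F t)" "finite (F' t)" "finite (G t)" for t
    unfolding F_def F'_def G_def using X by auto
  \<comment> \<open>\<open>B = C - {j}\<close> has the same trace on \<open>A\<close> as \<open>C\<close> if \<open>j\<close> is outside \<open>A\<close>, and a smaller one otherwise.\<close>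
  have outside: "(\<Sum>C\<in>G t. \<Sum>j\<in>C - A. y (C - {j})) = of_nat (card X - 2 * k + t) * (\<Sum>B\<in>F t. y B)"
    for t
  proof -
    have "(\<Sum>C\<in>G t. \<Sum>j\<in>C - A. y (C - {j})) = (\<Sum>(C, j)\<in>(SIGMA C:G t. C - A). y (C - {j}))"
      using finFG fin by (intro sum.Sigma) (auto simp: G_def)
    also have "\<dots> = (\<Sum>(B, j)\<in>(SIGMA B:F t. X - (B \<union> A)). y B)"
    proof (rule sum.reindex_bij_witness[where i = "\<lambda>(B, j). (insert j B, j)" and j = "\<lambda>(C, j). (C - {j}, j)"])
      fix p assume p: "p \<in> (SIGMA C:G t. C - A)"
      obtain C j where [simp]: "p = (C, j)" by (cases p)
      have "C \<inter> A - {j} = C \<inter> A" using p by auto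
      then show "(case p of (C, j) \<Rightarrow> (C - {j}, j)) \<in> (SIGMA B:F t. X - (B \<union> A))"
        using p fin[of C] by (auto simp: G_def F_def Diff_Int_distrib2)
      show "(case case p of (C, j) \<Rightarrow> (C - {j}, j) of (B, j) \<Rightarrow> (insert j B, j)) = p"
        using p by auto
      show "(case case p of (C, j) \<Rightarrow> (C - {j}, j) of (B, j) \<Rightarrow> y B) = (case p of (C, j) \<Rightarrow> y (C - {j}))"
        by simp
    next
      fix p assume p: "p \<in> (SIGMA B:F t. X - (B \<union> A))"
      obtain B j where [simp]: "p = (B, j)" by (cases p)
      show "(case p of (B, j) \<Rightarrow> (insert j B, j)) \<in> (SIGMA C:G t. C - A)"
        using p fin[of B] by (auto simp: G_def F_def)
      show "(case case p of (B, j) \<Rightarrow> (insert j B, j) of (C, j) \<Rightarrow> (C - {j}, j)) = p"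
        using p by auto
    qed
    also have "\<dots> = (\<Sum>B\<in>F t. \<Sum>j\<in>X - (B \<union> A). y B)"
      using finFG X by (intro sum.Sigma[symmetric]) auto
    also have "\<dots> = (\<Sum>B\<in>F t. of_nat (card X - 2 * k + t) * y B)"
    proof (rule sum.cong)
      fix B assume B: "B \<in> F t"
      then have "card (B \<union> A) + t = 2 * k"
        using card_Un_Int[of B A] fin A by (auto simp: F_def)
      moreover have "card (X - (B \<union> A)) = card X - card (B \<union> A)"
        using B A X by (intro card_Diff_subset) (auto simp: F_def intro: fin)
      moreover have "t \<le> k" using B fin A card_mono[of A "B \<inter> A"] by (auto simp: F_def)
      ultimately have "card (X - (B \<union> A)) = card X - 2 * k + t" using k by linarith
      then show "(\<Sum>j\<in>X - (B \<union> A). y B) = of_nat (card X - 2 * k + t) * y B" by simp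
    qed simp
    finally show ?thesis by (simp add: sum_distrib_left)
  qed
  have inside: "(\<Sum>C\<in>G t. \<Sum>j\<in>C \<inter> A. y (C - {j})) = of_nat (Suc k - t) * (\<Sum>B\<in>F' t. y B)"
    for t
  proof -
    have "(\<Sum>C\<in>G t. \<Sum>j\<in>C \<inter> A. y (C - {j})) = (\<Sum>(C, j)\<in>(SIGMA C:G t. C \<inter> A). y (C - {j}))"
      using finFG fin by (intro sum.Sigma) (auto simp: G_def)
    also have "\<dots> = (\<Sum>(B, j)\<in>(SIGMA B:F' t. A - B). y B)"
    proof (rule sum.reindex_bij_witness[where i = "\<lambda>(B, j). (insert j B, j)" and j = "\<lambda>(C, j). (C - {j}, j)"])
      fix p assume p: "p \<in> (SIGMA C:G t. C \<inter> A)"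
      obtain C j where [simp]: "p = (C, j)" by (cases p)
      have "(C - {j}) \<inter> A = C \<inter> A - {j}" by blast
      then have "Suc (card ((C - {j}) \<inter> A)) = card (C \<inter> A)" "Suc (card (C - {j})) = card C"
        using p fin[of C] by (auto simp: G_def card_Suc_Diff1 simp del: card_Diff_insert)
      then show "(case p of (C, j) \<Rightarrow> (C - {j}, j)) \<in> (SIGMA B:F' t. A - B)"
        using p by (auto simp: G_def F'_def simp del: card_Diff_insert)
      show "(case case p of (C, j) \<Rightarrow> (C - {j}, j) of (B, j) \<Rightarrow> (insert j B, j)) = p"
        using p by auto
      show "(case case p of (C, j) \<Rightarrow> (C - {j}, j) of (B, j) \<Rightarrow> y B) = (case p of (C, j) \<Rightarrow> y (C - {j}))"
        by simp
    next
      fix p assume p: "p \<in> (SIGMA B:F' t. A - B)"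
      obtain B j where [simp]: "p = (B, j)" by (cases p)
      show "(case p of (B, j) \<Rightarrow> (insert j B, j)) \<in> (SIGMA C:G t. C \<inter> A)"
        using p A fin[of B] by (auto simp: G_def F'_def)
      show "(case case p of (B, j) \<Rightarrow> (insert j B, j) of (C, j) \<Rightarrow> (C - {j}, j)) = p"
        using p by auto
    qed
    also have "\<dots> = (\<Sum>B\<in>F' t. \<Sum>j\<in>A - B. y B)"
      using finFG A by (intro sum.Sigma[symmetric]) (auto intro: fin)
    also have "\<dots> = (\<Sum>B\<in>F' t. of_nat (Suc k - t) * y B)"
    proof (rule sum.cong)
      fix B assume B: "B \<in> F' t"
      have "card (A - B) = card A - card (B \<inter> A)"
        using fin A by (metis card_Diff_subset_Int finite_Int Int_commute)
      then have "card (A - B) = Suc k - t" using B A by (auto simp: F'_def)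
      then show "(\<Sum>j\<in>A - B. y B) = of_nat (Suc k - t) * y B" by simp
    qed simp
    finally show ?thesis by (simp add: sum_distrib_left)
  qed
  have split: "of_nat (Suc k - t) * (\<Sum>B\<in>F' t. y B) + of_nat (card X - 2 * k + t) * (\<Sum>B\<in>F t. y B) = 0"
    for t
  proof -
    have "0 = (\<Sum>C\<in>G t. \<Sum>j\<in>C. y (C - {j}))"
      using ker by (intro sum.neutral[symmetric]) (auto simp: G_def)
    also have "\<dots> = (\<Sum>C\<in>G t. (\<Sum>j\<in>C \<inter> A. y (C - {j})) + (\<Sum>j\<in>C - A. y (C - {j})))"
      using fin by (intro sum.cong sum.Int_Diff) (auto simp: G_def)
    finally show ?thesis by (simp add: sum.distrib inside outside)
  qed
  have coeff: "(of_nat (card X - 2 * k + t) :: 'a) \<noteq> 0" for t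
  proof -
    have "card X - 2 * k + t \<noteq> 0" using k by simp
    then show ?thesis unfolding of_nat_eq_0_iff .
  qed
  have "(\<Sum>B\<in>F t. y B) = 0" for t
  proof (induction t)
    case 0
    have "F' 0 = {}" by (simp add: F'_def)
    then show ?case using split[of 0] coeff[of 0] by simp
  next
    case (Suc t)
    have "F' (Suc t) = F t" by (simp add: F'_def F_def)
    then show ?case using Suc split[of "Suc t"] coeff[of "Suc t"] by (simp del: of_nat_Suc of_nat_add add: add_eq_0_iff)
  qed
  moreover have "F k = {A}"
  proof -
    have "B = A" if "B \<subseteq> X" "card B = k" "card (B \<inter> A) = k" for B
      using that A fin by (metis card_subset_eq inf.cobounded1 inf.cobounded2)
    then show ?thesis using A by (auto simp: F_def)
  qed
  ultimately have "(\<Sum>B\<in>{A}. y B) = 0" by metis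
  then show ?thesis by simp
qed

text \<open>Complementation in \<open>X\<close> turns adding an element into removing one, so this is the previous lemma
  for the sets of size \<open>card X - k\<close>.\<close>

lemma down_operator_kernel_trivial:
  fixes y :: "'b set \<Rightarrow> 'a::field_char_0"
  assumes X: "finite X" and k: "card X < 2 * k"
    and ker: "\<And>C. C \<subseteq> X \<Longrightarrow> Suc (card C) = k \<Longrightarrow> (\<Sum>j\<in>X - C. y (insert j C)) = 0"
    and A: "A \<subseteq> X" "card A = k"
  shows "y A = 0"
proof -
  have "y (X - (X - A)) = 0"
  proof (rule up_operator_kernel_trivial[where y = "\<lambda>B. y (X - B)" and X = X and k = "card X - k"])
    have kle: "k \<le> card X" using A X card_mono by blast
    then show "2 * (card X - k) < card X" using k by linarith
    show "card (X - A) = card X - k" using A X by (simp add: card_Diff_subset finite_subset)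
    fix C assume C: "C \<subseteq> X" "card C = Suc (card X - k)"
    have "Suc (card (X - C)) = k"
      using C X kle card_mono[of X C] by (simp add: card_Diff_subset finite_subset)
    then have "(\<Sum>j\<in>X - (X - C). y (insert j (X - C))) = 0" by (intro ker) auto
    moreover have "X - (X - C) = C" using C by auto
    moreover have "insert j (X - C) = X - (C - {j})" if "j \<in> C" for j using C that by auto
    ultimately show "(\<Sum>j\<in>C. y (X - (C - {j}))) = 0" by simp
  qed (use X in auto)
  moreover have "X - (X - A) = A" using A by auto
  ultimately show ?thesis by simp
qed

section \<open>Exterior algebra tensor spinors\<close>

lemma shuffle_sign_square: "shuffle_sign T U * shuffle_sign T U = (1 :: 'a::comm_ring_1)"
  by (simp add: shuffle_sign_def flip: power_add mult_2)

text \<open>The sign is a character of the group of finite sets under symmetric difference: the common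
  elements contribute a square.\<close>

lemma shuffle_sign_sym_diff_right:
  assumes "finite T" "finite U" "finite V"
  shows "shuffle_sign T (sym_diff U V) = shuffle_sign T U * (shuffle_sign T V :: 'a::comm_ring_1)"
proof -
  let ?s = "shuffle_sign T :: _ \<Rightarrow> 'a"
  have split: "?s A = ?s (A - B) * ?s (A \<inter> B)" if "finite A" for A B
  proof -
    have "?s A = ?s ((A - B) \<union> (A \<inter> B))" by (rule arg_cong[where f = ?s]) auto
    also have "\<dots> = ?s (A - B) * ?s (A \<inter> B)"
      using assms that by (intro shuffle_sign_Un_right) auto
    finally show ?thesis .
  qed
  have U: "?s U = ?s (U - V) * ?s (U \<inter> V)" and V: "?s V = ?s (V - U) * ?s (U \<inter> V)"
    using split[of U V] split[of V U] assms by (simp_all add: Int_commute)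
  have "?s (sym_diff U V) = ?s (U - V) * ?s (V - U)"
    using assms by (intro shuffle_sign_Un_right) auto
  also have "\<dots> = ?s (U - V) * ?s (V - U) * (?s (U \<inter> V) * ?s (U \<inter> V))"
    by (simp add: shuffle_sign_square)
  also have "\<dots> = ?s U * ?s V"
    unfolding U V by (simp only: mult_ac)
  finally show ?thesis .
qed

text \<open>The sign with which \<open>j\<close> takes $e_S \otimes f_U$ to $e_{S \cup \{j\}} \otimes f_{U \triangle \{j\}}$: one factor from
  $e_j \wedge e_S$, the other from a Clifford generator acting on the spinor $f_U$.\<close>

definition spin_sign :: "nat \<Rightarrow> nat set \<Rightarrow> nat set \<Rightarrow> 'a::comm_ring_1" where
  "spin_sign j S U = shuffle_sign {j} S * shuffle_sign {j} U"

text \<open>The key to the block decomposition: with $V = S \triangle U$, the product of the two signs depends only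
  on \<open>j\<close> and \<open>V\<close>. It is therefore the quotient of the rescaling factors of $S \cup \{j\}$ and of $S$,
  where the factor of $S$ is \<open>shuffle_sign S V\<close>.\<close>

lemma spin_sign_block:
  assumes "finite S" "finite V" "j \<notin> S"
  shows "spin_sign j S (sym_diff S V) * shuffle_sign S V = (shuffle_sign (insert j S) V :: 'a::comm_ring_1)"
proof -
  have "spin_sign j S (sym_diff S V) = (shuffle_sign {j} V :: 'a)"
    using assms by (simp add: spin_sign_def shuffle_sign_sym_diff_right shuffle_sign_square
        flip: mult.assoc)
  moreover have "shuffle_sign (insert j S) V = (shuffle_sign {j} V * shuffle_sign S V :: 'a)"
    using shuffle_sign_Un_left[of "{j}" S V] assms by simp
  ultimately show ?thesis by simp
qed

text \<open>The matrix coefficients of $\sum_j (e_j \wedge {}) \otimes T_j$, where the row index \<open>p\<close> and the column index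
  \<open>q\<close> are pairs of a basis element $e_S$ of the exterior algebra and a spinor $f_U$.\<close>

definition spin_coeff :: "nat \<Rightarrow> nat set \<times> nat set \<Rightarrow> nat set \<times> nat set \<Rightarrow> 'a::comm_ring_1" where
  "spin_coeff n p q = (case (p, q) of ((S', U'), (S, U)) \<Rightarrow>
     \<Sum>j<n. if j \<notin> S \<and> S' = insert j S \<and> U' = sym_diff U {j} then spin_sign j S U else 0)"

abbreviation spin_basis :: "nat \<Rightarrow> nat \<Rightarrow> (nat set \<times> nat set) set" where
  "spin_basis i n \<equiv> {S. S \<subseteq> {..<n} \<and> card S = i} \<times> Pow {..<n}"

lemma finite_spin_basis: "finite (spin_basis i n)"
  by simp

lemma spin_row_sum:
  fixes x :: "nat set \<times> nat set \<Rightarrow> 'a::comm_ring_1"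
  assumes "(S', U') \<in> spin_basis (Suc i) n"
  shows "(\<Sum>q\<in>spin_basis i n. spin_coeff n (S', U') q * x q) =
    (\<Sum>j\<in>S'. spin_sign j (S' - {j}) (sym_diff U' {j}) * x (S' - {j}, sym_diff U' {j}))"
proof -
  have fin: "finite S'" using assms by (auto intro: finite_subset)
  let ?t = "\<lambda>j. (S' - {j}, sym_diff U' {j})"
  have "(\<Sum>q\<in>spin_basis i n. spin_coeff n (S', U') q * x q) =
      (\<Sum>q\<in>spin_basis i n. \<Sum>j<n. if j \<in> S' \<and> q = ?t j then spin_sign j (fst q) (snd q) * x q else 0)"
  proof (rule sum.cong)
    fix q assume "q \<in> spin_basis i n"
    obtain S U where q: "q = (S, U)" by (cases q)
    have "(j \<notin> S \<and> S' = insert j S \<and> U' = sym_diff U {j}) \<longleftrightarrow> (j \<in> S' \<and> q = ?t j)" for j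
      unfolding q by auto
    then show "spin_coeff n (S', U') q * x q =
        (\<Sum>j<n. if j \<in> S' \<and> q = ?t j then spin_sign j (fst q) (snd q) * x q else 0)"
      by (simp add: spin_coeff_def q sum_distrib_right if_distrib[of "\<lambda>z. z * _"] cong: if_cong)
  qed simp
  also have "\<dots> = (\<Sum>j<n. \<Sum>q\<in>spin_basis i n. if q = ?t j then (if j \<in> S' then spin_sign j (fst q) (snd q) * x q else 0) else 0)"
    by (subst sum.swap) (intro sum.cong, auto)
  also have "\<dots> = (\<Sum>j<n. if j \<in> S' then spin_sign j (fst (?t j)) (snd (?t j)) * x (?t j) else 0)"
  proof (rule sum.cong)
    fix j assume j: "j \<in> {..<n}"
    have "?t j \<in> spin_basis i n" if "j \<in> S'"
      using assms j that fin by auto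
    then show "(\<Sum>q\<in>spin_basis i n. if q = ?t j then (if j \<in> S' then spin_sign j (fst q) (snd q) * x q else 0) else 0)
      = (if j \<in> S' then spin_sign j (fst (?t j)) (snd (?t j)) * x (?t j) else 0)"
      by (subst sum.delta[OF finite_spin_basis]) auto
  qed simp
  also have "\<dots> = (\<Sum>j\<in>S'. spin_sign j (fst (?t j)) (snd (?t j)) * x (?t j))"
    using assms fin by (intro sum.mono_neutral_cong_right) auto
  finally show ?thesis by simp
qed

lemma spin_col_sum:
  fixes x :: "nat set \<times> nat set \<Rightarrow> 'a::comm_ring_1"
  assumes "(S, U) \<in> spin_basis i n"
  shows "(\<Sum>p\<in>spin_basis (Suc i) n. spin_coeff n p (S, U) * x p) =
    (\<Sum>j\<in>{..<n} - S. spin_sign j S U * x (insert j S, sym_diff U {j}))"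
proof -
  have fin: "finite S" using assms by (auto intro: finite_subset)
  let ?t = "\<lambda>j. (insert j S, sym_diff U {j})"
  have "(\<Sum>p\<in>spin_basis (Suc i) n. spin_coeff n p (S, U) * x p) =
      (\<Sum>p\<in>spin_basis (Suc i) n. \<Sum>j<n. if j \<notin> S \<and> p = ?t j then spin_sign j S U * x p else 0)"
  proof (rule sum.cong)
    fix p assume "p \<in> spin_basis (Suc i) n"
    obtain S' U' where p: "p = (S', U')" by (cases p)
    show "spin_coeff n p (S, U) * x p = (\<Sum>j<n. if j \<notin> S \<and> p = ?t j then spin_sign j S U * x p else 0)"
      by (simp add: spin_coeff_def p sum_distrib_right if_distrib[of "\<lambda>z. z * _"] cong: if_cong)
  qed simp
  also have "\<dots> = (\<Sum>j<n. \<Sum>p\<in>spin_basis (Suc i) n. if p = ?t j then (if j \<notin> S then spin_sign j S U * x p else 0) else 0)"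
    by (subst sum.swap) (intro sum.cong, auto)
  also have "\<dots> = (\<Sum>j<n. if j \<notin> S then spin_sign j S U * x (?t j) else 0)"
  proof (rule sum.cong)
    fix j assume j: "j \<in> {..<n}"
    have "?t j \<in> spin_basis (Suc i) n" if "j \<notin> S"
      using assms j that fin by auto
    then show "(\<Sum>p\<in>spin_basis (Suc i) n. if p = ?t j then (if j \<notin> S then spin_sign j S U * x p else 0) else 0)
      = (if j \<notin> S then spin_sign j S U * x (?t j) else 0)"
      by (subst sum.delta[OF finite_spin_basis]) auto
  qed simp
  also have "\<dots> = (\<Sum>j\<in>{..<n} - S. spin_sign j S U * x (?t j))"
    by (intro sum.mono_neutral_cong_right) auto
  finally show ?thesis .
qed

lemma shuffle_sign_nonzero: "shuffle_sign T U \<noteq> (0 :: 'a::field)"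
  by (simp add: shuffle_sign_def)

text \<open>The pairs $(S, U)$ with $S \triangle U = V$ form a block, and after rescaling by \<open>shuffle_sign S V\<close> the
  equations of the block are those of the inclusion matrix.\<close>

lemma spin_right_kernel_trivial:
  fixes x :: "nat set \<times> nat set \<Rightarrow> 'a::field_char_0"
  assumes i: "2 * i < n"
    and ker: "\<And>p. p \<in> spin_basis (Suc i) n \<Longrightarrow> (\<Sum>q\<in>spin_basis i n. spin_coeff n p q * x q) = 0"
    and q: "q \<in> spin_basis i n"
  shows "x q = 0"
proof -
  obtain S U where SU: "q = (S, U)" "S \<subseteq> {..<n}" "card S = i" "U \<subseteq> {..<n}" using q by auto
  define V where "V = sym_diff S U"
  have V: "V \<subseteq> {..<n}" "U = sym_diff S V" using SU by (auto simp: V_def)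
  have fin: "finite T" if "T \<subseteq> {..<n}" for T using that finite_subset by blast
  define y where "y T = shuffle_sign T V * x (T, sym_diff T V)" for T
  have "y S = 0"
  proof (rule up_operator_kernel_trivial[of "{..<n}" i])
    fix C assume C: "C \<subseteq> {..<n}" "card C = Suc i"
    let ?U = "sym_diff C V"
    have mem: "(C, ?U) \<in> spin_basis (Suc i) n" using C V by auto
    have "0 = (\<Sum>j\<in>C. spin_sign j (C - {j}) (sym_diff ?U {j}) * x (C - {j}, sym_diff ?U {j}))"
      using ker[OF mem] unfolding spin_row_sum[OF mem] ..
    also have "\<dots> = (\<Sum>j\<in>C. shuffle_sign C V * y (C - {j}))"
    proof (rule sum.cong)
      fix j assume j: "j \<in> C"
      have U: "sym_diff ?U {j} = sym_diff (C - {j}) V" using j by auto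
      have "spin_sign j (C - {j}) (sym_diff (C - {j}) V) =
          (spin_sign j (C - {j}) (sym_diff (C - {j}) V) * shuffle_sign (C - {j}) V) * shuffle_sign (C - {j}) V"
        by (simp only: mult.assoc shuffle_sign_square mult_1_right)
      also have "\<dots> = shuffle_sign C V * (shuffle_sign (C - {j}) V :: 'a)"
        using spin_sign_block[of "C - {j}" V j, where 'a = 'a] fin C V j by (simp add: insert_absorb)
      finally show "spin_sign j (C - {j}) (sym_diff ?U {j}) * x (C - {j}, sym_diff ?U {j}) =
          shuffle_sign C V * y (C - {j})"
        unfolding U y_def by (simp add: mult.assoc)
    qed simp
    finally show "(\<Sum>j\<in>C. y (C - {j})) = 0"
      by (simp add: shuffle_sign_nonzero flip: sum_distrib_left)
  qed (use i SU in auto)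
  then show ?thesis using V SU by (simp add: y_def shuffle_sign_nonzero)
qed

text \<open>The same rescaling works for the transposed matrix, whose blocks become transposed inclusion matrices.\<close>

lemma spin_left_kernel_trivial:
  fixes x :: "nat set \<times> nat set \<Rightarrow> 'a::field_char_0"
  assumes i: "n < 2 * Suc i"
    and ker: "\<And>q. q \<in> spin_basis i n \<Longrightarrow> (\<Sum>p\<in>spin_basis (Suc i) n. spin_coeff n p q * x p) = 0"
    and p: "p \<in> spin_basis (Suc i) n"
  shows "x p = 0"
proof -
  obtain S U where SU: "p = (S, U)" "S \<subseteq> {..<n}" "card S = Suc i" "U \<subseteq> {..<n}" using p by auto
  define V where "V = sym_diff S U"
  have V: "V \<subseteq> {..<n}" "U = sym_diff S V" using SU by (auto simp: V_def)
  have fin: "finite T" if "T \<subseteq> {..<n}" for T using that finite_subset by blast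
  define y where "y T = shuffle_sign T V * x (T, sym_diff T V)" for T
  have "y S = 0"
  proof (rule down_operator_kernel_trivial[of "{..<n}" "Suc i"])
    fix C assume C: "C \<subseteq> {..<n}" "Suc (card C) = Suc i"
    let ?U = "sym_diff C V"
    have mem: "(C, ?U) \<in> spin_basis i n" using C V by auto
    have "0 = (\<Sum>j\<in>{..<n} - C. spin_sign j C ?U * x (insert j C, sym_diff ?U {j}))"
      using ker[OF mem] unfolding spin_col_sum[OF mem] ..
    also have "\<dots> = (\<Sum>j\<in>{..<n} - C. shuffle_sign C V * y (insert j C))"
    proof (rule sum.cong)
      fix j assume j: "j \<in> {..<n} - C"
      have U: "sym_diff ?U {j} = sym_diff (insert j C) V" using j by auto
      have "spin_sign j C ?U = (spin_sign j C ?U * shuffle_sign C V) * shuffle_sign C V"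
        by (simp only: mult.assoc shuffle_sign_square mult_1_right)
      also have "\<dots> = shuffle_sign C V * (shuffle_sign (insert j C) V :: 'a)"
        using spin_sign_block[of C V j, where 'a = 'a] fin C V j by simp
      finally show "spin_sign j C ?U * x (insert j C, sym_diff ?U {j}) = shuffle_sign C V * y (insert j C)"
        unfolding U y_def by (simp add: mult.assoc)
    qed simp
    finally show "(\<Sum>j\<in>{..<n} - C. y (insert j C)) = 0"
      by (simp add: shuffle_sign_nonzero flip: sum_distrib_left)
  qed (use i SU in auto)
  then show ?thesis using V SU by (simp add: y_def shuffle_sign_nonzero)
qed

section \<open>Full non-commutative rank\<close>

text \<open>The row and column numbering of a Kronecker product, as a labelling by pairs.\<close>

lemma bij_betw_div_mod:
  assumes g: "bij_betw g {..<a} A" and h: "bij_betw h {..<b::nat} B"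
  shows "bij_betw (\<lambda>m. (g (m div b), h (m mod b))) {..<a * b} (A \<times> B)"
proof -
  have "bij_betw (\<lambda>m. (m div b, m mod b)) {..<a * b} ({..<a} \<times> {..<b})"
  proof (rule bij_betwI[where g = "\<lambda>(q, r). q * b + r"])
    have "q * b + r < a * b" if "q < a" "r < b" for q r
    proof -
      have "q * b + r < Suc q * b" using that by simp
      also have "\<dots> \<le> a * b" using that by (intro mult_le_mono1) simp
      finally show ?thesis .
    qed
    then show "(\<lambda>(q, r). q * b + r) \<in> {..<a} \<times> {..<b} \<rightarrow> {..<a * b}" by auto
    have "0 < b" if "m < a * b" for m using that by (cases b) auto
    then show "(\<lambda>m. (m div b, m mod b)) \<in> {..<a * b} \<rightarrow> {..<a} \<times> {..<b}"
      by (auto simp: less_mult_imp_div_less)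
  qed auto
  moreover have "bij_betw (map_prod g h) ({..<a} \<times> {..<b}) (A \<times> B)"
    using g h by (auto simp: bij_betw_def map_prod_inj_on map_prod_surj_on)
  ultimately have "bij_betw (map_prod g h \<circ> (\<lambda>m. (m div b, m mod b))) {..<a * b} (A \<times> B)"
    by (rule bij_betw_trans)
  then show ?thesis by (simp add: comp_def)
qed

lemma wedge_space_carrier: "wedge_space i n \<subseteq> carrier_mat (n choose (i + 1)) (n choose i)"
  by (auto simp: wedge_space_def ext_matrix_def)

text \<open>The operator $T_j f_U = \pm f_{U \triangle \{j\}}$ on the spinors $f_U$, where \<open>h\<close> numbers the subsets
  $U$. These operators have square 1, and any two different ones anticommute.\<close>

definition clifford_generator :: "nat \<Rightarrow> (nat \<Rightarrow> nat set) \<Rightarrow> nat \<Rightarrow> 'a::comm_ring_1 mat" where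
  "clifford_generator d h j = mat d d
     (\<lambda>(u', u). if h u' = sym_diff (h u) {j} then shuffle_sign {j} (h u) else 0)"

lemma ext_vec_unit_vec: "j < n \<Longrightarrow> ext_vec (unit_vec n j) = ext_basis {j}"
  by (rule ext) (simp add: ext_vec_def unit_vec_def if_distrib[of "\<lambda>z. z * _"] cong: if_cong)

lemma nth_ksubsets:
  assumes "r < n choose i"
  shows "ksubsets i n ! r \<subseteq> {..<n}" "card (ksubsets i n ! r) = i"
  using nth_mem[of r "ksubsets i n"] assms by (auto simp: length_ksubsets set_ksubsets)

lemma bij_betw_ksubsets: "bij_betw ((!) (ksubsets i n)) {..<n choose i} {S. S \<subseteq> {..<n} \<and> card S = i}"
  by (rule bij_betw_nth) (simp_all add: distinct_ksubsets length_ksubsets set_ksubsets)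

text \<open>The witness for full rank, $\sum_j L_{e_j} \otimes T_j$.\<close>

lemma spin_matrix_in_blow_up:
  assumes h: "bij_betw h {..<d} (Pow {..<n})"
  obtains B :: "'a::field mat" where "B \<in> blow_up (n choose (i + 1)) (n choose i) d (wedge_space i n)"
    and "\<And>r c. r < (n choose (i + 1)) * d \<Longrightarrow> c < (n choose i) * d \<Longrightarrow>
      B $$ (r, c) = spin_coeff n (ksubsets (i + 1) n ! (r div d), h (r mod d)) (ksubsets i n ! (c div d), h (c mod d))"
proof -
  let ?k = "n choose (i + 1)" and ?l = "n choose i"
  define L :: "nat \<Rightarrow> 'a mat" where "L j = ext_matrix i (i + 1) n (left_wedge (unit_vec n j))" for j
  define T :: "nat \<Rightarrow> 'a mat" where "T j = clifford_generator d h j" for j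
  define ps where "ps = map (\<lambda>j. (L j, T j)) [0..<n]"
  let ?Bs = "map (\<lambda>(A, T). A \<otimes>\<^sub>k T) ps"
  have dims: "L j \<in> carrier_mat ?k ?l" "T j \<in> carrier_mat d d" for j
    by (auto simp: L_def T_def ext_matrix_def clifford_generator_def)
  have "L j \<otimes>\<^sub>k T j \<in> carrier_mat (?k * d) (?l * d)" for j
    by (rule kronecker_carrier[OF dims])
  then have carrier: "set ?Bs \<subseteq> carrier_mat (?k * d) (?l * d)"
    by (auto simp: ps_def)
  have entry: "foldr (+) ?Bs (0\<^sub>m (?k * d) (?l * d)) $$ (r, c) =
      spin_coeff n (ksubsets (i + 1) n ! (r div d), h (r mod d)) (ksubsets i n ! (c div d), h (c mod d))"
    if r: "r < ?k * d" and c: "c < ?l * d" for r c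
  proof -
    have d: "d > 0" using r by (cases d) auto
    have rc: "r div d < ?k" "c div d < ?l" "r mod d < d" "c mod d < d"
      using r c d by (auto simp: less_mult_imp_div_less)
    let ?S' = "ksubsets (i + 1) n ! (r div d)" and ?S = "ksubsets i n ! (c div d)"
    have fin: "finite ?S" using nth_ksubsets(1)[OF rc(2)] finite_subset by blast
    have "foldr (+) ?Bs (0\<^sub>m (?k * d) (?l * d)) $$ (r, c) = (\<Sum>B\<leftarrow>?Bs. B $$ (r, c))"
      using foldr_plus_mat(2)[OF carrier r c] .
    also have "\<dots> = (\<Sum>j<n. (L j \<otimes>\<^sub>k T j) $$ (r, c))"
      by (simp add: ps_def comp_def interv_sum_list_conv_sum_set_nat atLeast0LessThan)
    also have "\<dots> = (\<Sum>j<n. if j \<notin> ?S \<and> ?S' = insert j ?S \<and> h (r mod d) = sym_diff (h (c mod d)) {j}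
        then spin_sign j ?S (h (c mod d)) else 0)"
    proof (rule sum.cong)
      fix j assume j: "j \<in> {..<n}"
      have "(L j \<otimes>\<^sub>k T j) $$ (r, c) = L j $$ (r div d, c div d) * T j $$ (r mod d, c mod d)"
        using dims[of j] r c by (simp add: kronecker_def)
      moreover have "L j $$ (r div d, c div d) =
          (if j \<notin> ?S then shuffle_sign {j} ?S * ext_basis (insert j ?S) ?S' else 0)"
        using rc j fin by (simp add: L_def ext_matrix_def left_wedge_def ext_vec_unit_vec wedge_ext_basis)
      moreover have "T j $$ (r mod d, c mod d) =
          (if h (r mod d) = sym_diff (h (c mod d)) {j} then shuffle_sign {j} (h (c mod d)) else 0)"
        using rc by (simp add: T_def clifford_generator_def)
      ultimately show "(L j \<otimes>\<^sub>k T j) $$ (r, c) =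
          (if j \<notin> ?S \<and> ?S' = insert j ?S \<and> h (r mod d) = sym_diff (h (c mod d)) {j}
           then spin_sign j ?S (h (c mod d)) else 0)"
        by (simp add: spin_sign_def ext_basis_def)
    qed simp
    finally show ?thesis by (simp add: spin_coeff_def)
  qed
  have "set ps \<subseteq> wedge_space i n \<times> carrier_mat d d"
    using dims by (auto simp: ps_def wedge_space_def L_def)
  then have "foldr (+) ?Bs (0\<^sub>m (?k * d) (?l * d)) \<in> blow_up ?k ?l d (wedge_space i n)"
    unfolding blow_up_def by blast
  with entry show thesis by (rule that[rotated])
qed

text \<open>If $2i < n$ the columns of the witness are independent, otherwise its rows are; in both cases its
  rank is then the smaller dimension, since it is bounded by both.\<close>

theorem ncrk_wedge_space:
  "ncrk (n choose (i + 1)) (n choose i) (wedge_space i n :: 'a::field_char_0 mat set)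
     = real (min (n choose i) (n choose (i + 1)))"
proof -
  let ?k = "n choose (i + 1)" and ?l = "n choose i"
  define d :: nat where "d = 2 ^ n"
  obtain h where h: "bij_betw h {..<d} (Pow {..<n})"
    using ex_bij_betw_nat_finite[of "Pow {..<n}"] by (auto simp: d_def card_Pow atLeast0LessThan)
  obtain B :: "'a mat" where B: "B \<in> blow_up ?k ?l d (wedge_space i n)"
    and entry: "\<And>r c. r < ?k * d \<Longrightarrow> c < ?l * d \<Longrightarrow>
      B $$ (r, c) = spin_coeff n (ksubsets (i + 1) n ! (r div d), h (r mod d)) (ksubsets i n ! (c div d), h (c mod d))"
    using spin_matrix_in_blow_up[OF h] by blast
  have car: "B \<in> carrier_mat (?k * d) (?l * d)"
    using B blow_up_carrier[OF wedge_space_carrier] by blast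
  note rows = bij_betw_div_mod[OF bij_betw_ksubsets[of "i + 1" n] h]
  note cols = bij_betw_div_mod[OF bij_betw_ksubsets[of i n] h]
  let ?r = "vec_space.rank (?k * d) B"
  have "?r = ?l * d \<or> ?r = ?k * d"
  proof (cases "2 * i < n")
    case True
    have "?r = ?l * d"
    proof (rule rank_eq_dim_col_labelled[OF car rows cols, where E = "spin_coeff n"], goal_cases)
      case (1 r c)
      then show ?case by (rule entry)
    next
      case (2 x q)
      then show ?case
        unfolding Suc_eq_plus1[symmetric] by (rule spin_right_kernel_trivial[OF True])
    qed
    then show ?thesis ..
  next
    case False
    then have i: "n < 2 * Suc i" by simp
    have "?r = ?k * d"
    proof (rule rank_eq_dim_row_labelled[OF car rows cols, where E = "spin_coeff n"], goal_cases)
      case (1 r c)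
      then show ?case by (rule entry)
    next
      case (2 x p)
      then show ?case
        unfolding Suc_eq_plus1[symmetric] by (rule spin_left_kernel_trivial[OF i])
    qed
    then show ?thesis ..
  qed
  moreover have "?r \<le> ?k * d" "?r \<le> ?l * d"
    using vec_space.rank_le_nr[OF car] vec_space.rank_le_nc[OF car] by auto
  ultimately have "?r = min ?k ?l * d" by (auto simp: min_def d_def split: if_splits)
  then show ?thesis
    using ncrk_eq_min[OF wedge_space_carrier _ B] by (simp add: d_def min.commute)
qed

section \<open>Deficient rank\<close>

lemma left_wedge_left_wedge: "left_wedge v (left_wedge v x) = (\<lambda>S. 0)"
  by (simp add: left_wedge_def wedge_ext_vec_ext_vec flip: wedge_assoc) (simp add: wedge_def)

lemma left_wedge_basis_insert:
  assumes "finite T" "j \<notin> T" "j < dim_vec v"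
  shows "left_wedge v (ext_basis T) (insert j T) = shuffle_sign {j} T * v $ j"
proof -
  have "left_wedge v (ext_basis T) (insert j T) =
      (\<Sum>W\<in>Pow (insert j T). if W = {j} then shuffle_sign {j} T * v $ j else 0)"
    unfolding left_wedge_def wedge_def
  proof (rule sum.cong)
    fix W assume W: "W \<in> Pow (insert j T)"
    have iff: "insert j T - W = T \<longleftrightarrow> W = {j}" using W assms(2) by auto
    have "ext_vec v {j} = (\<Sum>k<dim_vec v. if k = j then v $ k else 0)"
      unfolding ext_vec_def by (rule sum.cong) (auto simp: ext_basis_def)
    also have "\<dots> = v $ j" using assms(3) by simp
    finally have vec: "ext_vec v {j} = v $ j" .
    show "shuffle_sign W (insert j T - W) * ext_vec v W * ext_basis T (insert j T - W) =
        (if W = {j} then shuffle_sign {j} T * v $ j else 0)"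
    proof (cases "W = {j}")
      case True
      then have "insert j T - W = T" using iff by simp
      with True show ?thesis by (simp only: vec ext_basis_def simp_thms if_True mult_1_right)
    next
      case False
      then have "insert j T - W \<noteq> T" using iff by simp
      with False show ?thesis by (simp only: ext_basis_def simp_thms if_False mult_zero_right)
    qed
  qed simp
  also have "\<dots> = shuffle_sign {j} T * v $ j"
    using assms(1) by simp
  finally show ?thesis .
qed

text \<open>If $v_j \neq 0$ and $j \notin T$, then only the \<open>j\<close>-th component of $v$ contributes to the coefficient
  of $v \wedge e_T$ at $T \cup \{j\}$.\<close>

lemma left_wedge_nonzero:
  fixes v :: "'a::field vec"
  assumes v: "v \<in> carrier_vec n" "v \<noteq> 0\<^sub>v n" and m: "m < n"
  obtains S T where "S \<subseteq> {..<n}" "card S = Suc m" "T \<subseteq> {..<n}" "card T = m"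
    "left_wedge v (ext_basis T) S \<noteq> 0"
proof -
  obtain j where j: "j < n" "v $ j \<noteq> 0" using v by (auto simp: vec_eq_iff)
  have "m \<le> card ({..<n} - {j})" using j m by simp
  then obtain T where T: "T \<subseteq> {..<n} - {j}" "card T = m" "finite T"
    using obtain_subset_with_card_n by metis
  then have "j \<notin> T" by blast
  then have "left_wedge v (ext_basis T) (insert j T) \<noteq> 0"
    using left_wedge_basis_insert[of T j v] T j v by (simp add: shuffle_sign_def)
  with T j \<open>j \<notin> T\<close> show thesis by (intro that[of "insert j T" T]) auto
qed

lemma ext_basis_ext_power: "S \<subseteq> {..<n} \<Longrightarrow> card S = i \<Longrightarrow> ext_basis S \<in> ext_power i n"
  by (auto simp: ext_power_def ext_basis_def)

lemma left_wedge_matrix_mult_coords: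
  assumes "x \<in> ext_power i n"
  shows "ext_matrix i (i + 1) n (left_wedge v) *\<^sub>v ext_coords i n x = ext_coords (i + 1) n (left_wedge v x)"
  by (rule ext_matrix_mult_coords[OF _ _ assms])
    (simp_all add: left_wedge_def wedge_add_right wedge_smult_right)

lemma ext_coords_zero: "ext_coords i n (\<lambda>S. 0) = 0\<^sub>v (n choose i)"
  by (auto simp: ext_coords_def)

lemma col_ext_matrix:
  "c < n choose i \<Longrightarrow> col (ext_matrix i j n F) c = ext_coords j n (F (ext_basis (ksubsets i n ! c)))"
  by (rule eq_vecI) (simp_all add: ext_matrix_def ext_coords_def)

text \<open>Covers $v = 0$, where any nonzero \<open>w\<close> will do, together with the main case $w = v$.\<close>

lemma exists_nonzero_annihilating_vec:
  fixes v :: "'a::field vec"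
  assumes v: "v \<in> carrier_vec n" and n: "0 < n"
  obtains w where "w \<in> carrier_vec n" "w \<noteq> 0\<^sub>v n"
    "\<And>x. left_wedge v (left_wedge w x) = (\<lambda>S. 0)" "\<And>x. left_wedge w (left_wedge v x) = (\<lambda>S. 0)"
proof (cases "v = 0\<^sub>v n")
  case True
  then have "ext_vec v = (\<lambda>S. 0)" by (simp add: ext_vec_def)
  then have "left_wedge v x = (\<lambda>S. 0)" "left_wedge w (\<lambda>S. 0) = (\<lambda>S. 0)" for w :: "'a vec" and x
    by (simp_all add: left_wedge_def wedge_def)
  then show thesis using n by (intro that[of "unit_vec n 0"]) auto
next
  case False
  then show thesis using v by (intro that[of v]) (auto simp: left_wedge_left_wedge)
qed

text \<open>Let $w \neq 0$ with $v \wedge w = 0$. A nonzero element of $w \wedge \bigwedge^{i-1} K^n$ is in the kernel of $L_v$, and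
  since $L_w L_v = 0$, a nonzero row of the matrix of $L_w$ on $\bigwedge^{i+1} K^n$ is orthogonal to the image of $L_v$.
  The two bounds on \<open>i\<close> say that both exist.\<close>

theorem max_rank_wedge_space_less:
  assumes i: "0 < i" "i + 1 < n"
  shows "max_rank (wedge_space i n :: 'a::field mat set) < min (n choose i) (n choose (i + 1))"
proof -
  let ?k = "n choose (i + 1)" and ?l = "n choose i"
  have "wedge_space i n \<noteq> ({} :: 'a mat set)"
    unfolding wedge_space_def using zero_carrier_vec by blast
  then obtain A :: "'a mat" where A: "A \<in> wedge_space i n" "max_rank (wedge_space i n :: 'a mat set) = vec_space.rank ?k A"
    using max_rank_attained(1)[OF wedge_space_carrier] by metis
  obtain v where v: "v \<in> carrier_vec n" and Av: "A = ext_matrix i (i + 1) n (left_wedge v)"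
    using A(1) by (auto simp: wedge_space_def)
  have car: "A \<in> carrier_mat ?k ?l" using A(1) wedge_space_carrier by blast
  obtain w where w: "w \<in> carrier_vec n" "w \<noteq> 0\<^sub>v n"
    and ann: "\<And>x. left_wedge v (left_wedge w x) = (\<lambda>S. 0)" "\<And>x. left_wedge w (left_wedge v x) = (\<lambda>S. 0)"
    using exists_nonzero_annihilating_vec[OF v] i by auto
  have index: "\<exists>r < n choose m. ksubsets m n ! r = S" if "S \<subseteq> {..<n}" "card S = m" for S m
  proof -
    have "S \<in> (!) (ksubsets m n) ` {..<n choose m}"
      unfolding bij_betw_imp_surj_on[OF bij_betw_ksubsets[of m n]] using that by blast
    then show ?thesis by blast
  qed
  have "vec_space.rank ?k A < ?l"
  proof -
    obtain S T where ST: "S \<subseteq> {..<n}" "card S = i" "T \<subseteq> {..<n}" "card T = i - 1"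
      "left_wedge w (ext_basis T) S \<noteq> 0"
      using left_wedge_nonzero[OF w, of "i - 1"] i by (metis Suc_diff_1 Suc_lessD add_lessD1 less_imp_diff_less)
    let ?x = "left_wedge w (ext_basis T)"
    have x: "?x \<in> ext_power i n"
      using left_wedge_ext_power[OF w(1) ext_basis_ext_power[OF ST(3,4)]] i by simp
    obtain r where r: "r < ?l" "ksubsets i n ! r = S" using index[OF ST(1,2)] by blast
    have "ext_coords i n ?x $ r \<noteq> 0" using r ST(5) by (simp add: ext_coords_def)
    then have "ext_coords i n ?x \<noteq> 0\<^sub>v ?l" using r by auto
    moreover have "A *\<^sub>v ext_coords i n ?x = 0\<^sub>v ?k"
      unfolding Av left_wedge_matrix_mult_coords[OF x] by (simp add: ann ext_coords_zero)
    moreover have "ext_coords i n ?x \<in> carrier_vec ?l" by (simp add: ext_coords_def)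
    ultimately show ?thesis using vec_space.rank_less_nc_iff[OF car] by blast
  qed
  moreover have "vec_space.rank ?k A < ?k"
  proof -
    obtain S T where ST: "S \<subseteq> {..<n}" "card S = Suc (i + 1)" "T \<subseteq> {..<n}" "card T = i + 1"
      "left_wedge w (ext_basis T) S \<noteq> 0"
      using left_wedge_nonzero[OF w i(2)] .
    define M where "M = ext_matrix (i + 1) (i + 1 + 1) n (left_wedge w)"
    obtain r where r: "r < n choose (i + 1 + 1)" "ksubsets (i + 1 + 1) n ! r = S"
      using index[of S "i + 1 + 1"] ST by auto
    obtain c where c: "c < ?k" "ksubsets (i + 1) n ! c = T" using index[OF ST(3,4)] by blast
    have M: "M \<in> carrier_mat (n choose (i + 1 + 1)) ?k" by (simp add: M_def ext_matrix_def)
    have "row M r $ c \<noteq> 0" using r c ST(5) by (simp add: M_def ext_matrix_def)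
    then have "row M r \<noteq> 0\<^sub>v ?k" using c by auto
    moreover have "row M r \<in> carrier_vec ?k" using M r by auto
    moreover have "row M r \<bullet> col A c' = 0" if c': "c' < ?l" for c'
    proof -
      let ?x = "left_wedge v (ext_basis (ksubsets i n ! c'))"
      have x: "?x \<in> ext_power (i + 1) n"
        by (intro left_wedge_ext_power v ext_basis_ext_power nth_ksubsets c')
      have "row M r \<bullet> col A c' = (M *\<^sub>v col A c') $ r" using M r by simp
      also have "M *\<^sub>v col A c' = ext_coords (i + 1 + 1) n (left_wedge w ?x)"
        unfolding Av col_ext_matrix[OF c'] M_def by (rule left_wedge_matrix_mult_coords[OF x])
      also have "\<dots> $ r = 0" using r by (simp add: ann ext_coords_def)
      finally show ?thesis .
    qed
    ultimately show ?thesis using vec_space.rank_less_nr_iff[OF car] by blast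
  qed
  ultimately show ?thesis using A(2) by simp
qed

theorem corollary1p16:
  fixes i n :: nat
  assumes "n \<ge> 1" and "i \<le> n - 1"
  shows "ncrk (n choose (i + 1)) (n choose i) (wedge_space i n :: 'a::field_char_0 mat set)
           = real (min (n choose i) (n choose (i + 1))) \<and>
         (i \<noteq> 0 \<and> i \<noteq> n - 1 \<longrightarrow>
           max_rank (wedge_space i n :: 'a mat set) < min (n choose i) (n choose (i + 1)))"
  using ncrk_wedge_space max_rank_wedge_space_less[of i n, where 'a = 'a] assms by auto

end
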